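(* For each integer $\ell\geq 3$ there exist a graph $G_\ell$ with $\omega(G_\ell)=\ell$ and a clique partition $\mathcal{X}_\ell$ of $G_\ell$ that can be output by the algorithm \textsc{Greedy Edmonds} on input $G_\ell$, such that \[ \lim_{\ell\to\infty}\frac{\binom{\ell}{2}+1}{2\binom{\ell}{2}}\cdot\frac{\mathsf{OPT}_\ell}{|E(\mathcal{X}_\ell)|}=1, \] where $\mathsf{OPT}_\ell$ is the maximum number of edges in a clique partition of $G_\ell$.
   Context: $\omega(G)$ is the maximum size of a clique of $G$. A clique partition of $G$ is a partition of $V(G)$ into cliques; for a clique partition $\mathcal{X}$, $E(\mathcal{X})$ is the set of edges of $G$ with both ends in the same part, and the number of edges of the clique partition is $|E(\mathcal{X})|$. The algorithm \textsc{Greedy Edmonds} on input $G$: set $\mathcal{X}=\emptyset$; while $G$ has a vertex: if $\omega(G)=2$, compute a maximum matching $\mathcal{M}$ of $G$, add each edge of $\mathcal{M}$ (as a 2-vertex clique) to $\mathcal{X}$, and replace $G$ by $G-V(\mathcal{M})$; otherwise choose any maximum clique $X$ of $G$, add $X$ to $\mathcal{X}$ and replace $G$ by $G-X$. Output $\mathcal{X}$ (different choices of maximum cliques/matchings may give different outputs). *)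

theory Defs
  imports Complex_Main "HOL-Library.Disjoint_Sets"
begin

record 'a ugraph =
  verts :: "'a set"
  edges :: "'a set set"

definition simple_graph :: "'a ugraph \<Rightarrow> bool" where
  "simple_graph G \<longleftrightarrow> finite (verts G) \<and> (\<forall>e \<in> edges G. e \<subseteq> verts G \<and> card e = 2)"

definition delete_verts :: "'a ugraph \<Rightarrow> 'a set \<Rightarrow> 'a ugraph" where
  "delete_verts G S = \<lparr> verts = verts G - S, edges = {e \<in> edges G. e \<inter> S = {}} \<rparr>"

definition clique :: "'a ugraph \<Rightarrow> 'a set \<Rightarrow> bool" where
  "clique G K \<longleftrightarrow> K \<subseteq> verts G \<and> pairwise (\<lambda>u v. {u, v} \<in> edges G) K"

text \<open>The empty set counts as a clique, so the graph without vertices has clique number 0.\<close>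

definition clique_number :: "'a ugraph \<Rightarrow> nat" where
  "clique_number G = Max (card ` {K. clique G K})"

definition maximum_clique :: "'a ugraph \<Rightarrow> 'a set \<Rightarrow> bool" where
  "maximum_clique G K \<longleftrightarrow> clique G K \<and> card K = clique_number G"

definition matching :: "'a ugraph \<Rightarrow> 'a set set \<Rightarrow> bool" where
  "matching G M \<longleftrightarrow> M \<subseteq> edges G \<and> disjoint M"

definition maximum_matching :: "'a ugraph \<Rightarrow> 'a set set \<Rightarrow> bool" where
  "maximum_matching G M \<longleftrightarrow> matching G M \<and> (\<forall>M'. matching G M' \<longrightarrow> card M' \<le> card M)"

definition clique_partition :: "'a ugraph \<Rightarrow> 'a set set \<Rightarrow> bool" where
  "clique_partition G X \<longleftrightarrow> partition_on (verts G) X \<and> (\<forall>K \<in> X. clique G K)"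

definition partition_edges :: "'a ugraph \<Rightarrow> 'a set set \<Rightarrow> 'a set set" where
  "partition_edges G X = {e \<in> edges G. \<exists>K \<in> X. e \<subseteq> K}"

definition OPT :: "'a ugraph \<Rightarrow> nat" where
  "OPT G = Max ((\<lambda>X. card (partition_edges G X)) ` {X. clique_partition G X})"

text \<open>
  One iteration of the while loop, acting on pairs of the current graph and the set of cliques
  collected so far. An edge is the set of its two ends, so the edges of a matching are themselves
  the 2-vertex cliques to be added, and the set of matched vertices is the union of the matching.
\<close>

inductive greedy_edmonds_step ::
  "'a ugraph \<times> 'a set set \<Rightarrow> 'a ugraph \<times> 'a set set \<Rightarrow> bool" where
  matching_step:
    "\<lbrakk>verts G \<noteq> {}; clique_number G = 2; maximum_matching G M\<rbrakk>
      \<Longrightarrow> greedy_edmonds_step (G, X) (delete_verts G (\<Union>M), X \<union> M)"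
| clique_step:
    "\<lbrakk>verts G \<noteq> {}; clique_number G \<noteq> 2; maximum_clique G K\<rbrakk>
      \<Longrightarrow> greedy_edmonds_step (G, X) (delete_verts G K, insert K X)"

definition greedy_edmonds_output :: "'a ugraph \<Rightarrow> 'a set set \<Rightarrow> bool" where
  "greedy_edmonds_output G X \<longleftrightarrow>
     (\<exists>H. greedy_edmonds_step\<^sup>*\<^sup>* (G, {}) (H, X) \<and> verts H = {})"

end

theory Submission
  imports Defs "HOL-Library.Nat_Bijection"
begin

text \<open>
  Take $N = \ell!$ rows of $\ell$ vertices each, the vertices of a row lying on levels
  $1, \dots, \ell$, and make every row a clique. Moreover cut level $c$ into $N / c$ blocks of $c$
  vertices and make every block a clique. Every clique is contained in a row or in a block, so the
  rows form an optimal partition, with $N \binom{\ell}{2}$ edges. When only the levels $1, \dots, k$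
  are left, the blocks of level $k$ are maximum cliques, and removing them leads to $k - 1$. Hence
  the algorithm may remove the levels $\ell, \dots, 3$ blockwise, after which the rows form a
  perfect matching. In the output a vertex of level $c$ is in a part of size $\max(2, c)$, so
  twice the number of its edges is
  $N \sum_{c=1}^{\ell} (\max(2, c) - 1) = N \left(\binom{\ell}{2} + 1\right)$, and the sequence in
  the theorem is constantly $1$ for $\ell \ge 3$.
\<close>

section \<open>Clique partitions\<close>

lemma clique_number_eqI:
  assumes "finite (verts G)" "clique G K" "card K = n" "\<And>K. clique G K \<Longrightarrow> card K \<le> n"
  shows "clique_number G = n"
  unfolding clique_number_def
proof (rule Max_eqI)
  have "{K. clique G K} \<subseteq> Pow (verts G)"
    by (auto simp: clique_def)
  then show "finite (card ` {K. clique G K})"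
    using assms(1) by (meson finite_Pow_iff finite_imageI finite_subset)
qed (use assms in \<open>force+\<close>)

lemma two_times_choose_two: "2 * (n choose 2) = n * (n - 1)"
  by (cases n) (simp_all add: choose_two)

text \<open>A part of size s has s * (s - 1) / 2 edges, so after doubling each of its vertices
  accounts for s - 1. This turns edge counts into sums over vertices.\<close>

lemma card_partition_edges:
  assumes "simple_graph G" "clique_partition G X"
  shows "2 * card (partition_edges G X) = (\<Sum>K\<in>X. \<Sum>v\<in>K. card K - 1)"
proof -
  have X: "partition_on (verts G) X" and cl: "\<And>K. K \<in> X \<Longrightarrow> clique G K"
    and fin: "finite (verts G)"
    using assms by (auto simp: clique_partition_def simple_graph_def)
  have finX: "finite X"
    using X fin by (rule finite_elements[rotated])
  have finK: "finite K" if "K \<in> X" for K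
    using cl[OF that] fin by (auto simp: clique_def intro: finite_subset)
  let ?E = "\<lambda>K. {e. e \<subseteq> K \<and> card e = 2}"
  \<comment> \<open>Since parts are cliques, every pair inside a part is an edge, and only part
    sizes matter from here on.\<close>
  have "partition_edges G X = (\<Union>K\<in>X. ?E K)"
  proof
    show "partition_edges G X \<subseteq> (\<Union>K\<in>X. ?E K)"
      using assms(1) by (auto simp: partition_edges_def simple_graph_def)
  next
    show "(\<Union>K\<in>X. ?E K) \<subseteq> partition_edges G X"
    proof clarify
      fix K e assume K: "K \<in> X" and e: "e \<subseteq> K" "card e = 2"
      then obtain u v where "e = {u, v}" "u \<noteq> v"
        by (auto simp: card_2_iff)
      then show "e \<in> partition_edges G X"
        using cl[OF K] K e by (auto simp: partition_edges_def clique_def pairwise_def)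
    qed
  qed
  moreover have "card (\<Union>K\<in>X. ?E K) = (\<Sum>K\<in>X. card (?E K))"
  proof (rule card_UN_disjoint)
    show "\<forall>K\<in>X. \<forall>K'\<in>X. K \<noteq> K' \<longrightarrow> ?E K \<inter> ?E K' = {}"
    proof (intro ballI impI)
      fix K K' assume "K \<in> X" "K' \<in> X" "K \<noteq> K'"
      then have "K \<inter> K' = {}"
        using X by (auto simp: partition_on_def disjoint_def)
      then show "?E K \<inter> ?E K' = {}"
        by (auto simp: card_2_iff)
    qed
  qed (use finX finK in auto)
  moreover have "card (?E K) = card K choose 2" if "K \<in> X" for K
    using n_subsets[OF finK[OF that]] by simp
  ultimately have "2 * card (partition_edges G X) = (\<Sum>K\<in>X. 2 * (card K choose 2))"
    by (simp add: sum_distrib_left)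
  also have "\<dots> = (\<Sum>K\<in>X. \<Sum>v\<in>K. card K - 1)"
    by (intro sum.cong) (simp_all add: two_times_choose_two)
  finally show ?thesis .
qed

lemma sum_over_partition:
  assumes "finite V" "partition_on V X"
  shows "(\<Sum>K\<in>X. \<Sum>v\<in>K. f v) = (\<Sum>v\<in>V. f v :: nat)"
proof -
  have "finite K" if "K \<in> X" for K
    using assms that by (metis Union_upper finite_subset partition_on_def)
  then show ?thesis
    using assms sum.Union_disjoint[of X f] by (auto simp: partition_on_def disjoint_def)
qed

text \<open>Here \<open>f\<close> reads the part size off the vertex: it is constant for the rows
  and depends on the level for the output of the algorithm.\<close>

lemma card_partition_edges_eq:
  assumes "simple_graph G" "clique_partition G X"
    and "\<And>K v. K \<in> X \<Longrightarrow> v \<in> K \<Longrightarrow> card K = f v"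
  shows "2 * card (partition_edges G X) = (\<Sum>v\<in>verts G. f v - 1)"
proof -
  have "(\<Sum>K\<in>X. \<Sum>v\<in>K. card K - 1) = (\<Sum>K\<in>X. \<Sum>v\<in>K. f v - 1)"
    using assms(3) by (intro sum.cong) auto
  then show ?thesis
    using assms(1,2) card_partition_edges[of G X] sum_over_partition[of "verts G" X "\<lambda>v. f v - 1"]
    by (simp add: simple_graph_def clique_partition_def)
qed

text \<open>No vertex accounts for more than \<open>l - 1\<close>; this is the upper bound on the
  optimum.\<close>

lemma card_partition_edges_le:
  assumes "simple_graph G" "clique_partition G X" "\<And>K. clique G K \<Longrightarrow> card K \<le> l"
  shows "2 * card (partition_edges G X) \<le> card (verts G) * (l - 1)"
proof -
  have "(\<Sum>K\<in>X. \<Sum>v\<in>K. card K - 1) \<le> (\<Sum>K\<in>X. \<Sum>v\<in>K. l - 1)"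
  proof (intro sum_mono)
    fix K v assume "K \<in> X"
    then show "card K - 1 \<le> l - 1"
      using assms(2,3) by (intro diff_le_mono) (simp add: clique_partition_def)
  qed
  also have "\<dots> = card (verts G) * (l - 1)"
    using assms(1,2) sum_over_partition[of "verts G" X "\<lambda>v. l - 1"]
    by (simp add: simple_graph_def clique_partition_def)
  finally show ?thesis
    using assms(1,2) by (simp add: card_partition_edges)
qed

lemma OPT_eqI:
  assumes "simple_graph G" "clique_partition G X"
    and "\<And>Y. clique_partition G Y \<Longrightarrow> card (partition_edges G Y) \<le> card (partition_edges G X)"
  shows "OPT G = card (partition_edges G X)"
  unfolding OPT_def
proof (rule Max_eqI)
  have "{X. clique_partition G X} \<subseteq> Pow (Pow (verts G))"
    by (auto simp: clique_partition_def partition_on_def)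
  then show "finite ((\<lambda>X. card (partition_edges G X)) ` {X. clique_partition G X})"
    using assms(1) unfolding simple_graph_def
    by (meson finite_Pow_iff finite_imageI finite_subset)
qed (use assms in auto)

lemma card_matching_le:
  assumes "simple_graph G" "matching G M"
  shows "2 * card M \<le> card (verts G)"
proof -
  have sub: "\<Union>M \<subseteq> verts G" and two: "\<And>e. e \<in> M \<Longrightarrow> card e = 2" and fin: "finite (verts G)"
    using assms by (auto simp: simple_graph_def matching_def)
  have "card (\<Union>M) = (\<Sum>e\<in>M. card e)"
    using assms(2) two by (intro card_Union_disjoint)
      (auto simp: matching_def disjoint_def pairwise_def disjnt_def intro: card_ge_0_finite)
  also have "\<dots> = 2 * card M"
    using two by simp
  finally show ?thesis
    using card_mono[OF fin sub] by simp
qed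

section \<open>The graph\<close>

text \<open>The pairing bijection gives every natural number a row and a level, so the vertices can
  have the type \<open>nat\<close> used in the theorem.\<close>

definition cell :: "nat \<Rightarrow> nat \<Rightarrow> nat" where
  "cell i c = prod_encode (i, c)"

definition row :: "nat \<Rightarrow> nat" where
  "row v = fst (prod_decode v)"

definition lev :: "nat \<Rightarrow> nat" where
  "lev v = snd (prod_decode v)"

lemma row_cell [simp]: "row (cell i c) = i" and lev_cell [simp]: "lev (cell i c) = c"
  by (auto simp: cell_def row_def lev_def)

lemma cell_row_lev [simp]: "cell (row v) (lev v) = v"
  by (simp add: cell_def row_def lev_def)

lemma eq_cell_iff: "v = cell i c \<longleftrightarrow> row v = i \<and> lev v = c"
  by auto

lemma cell_eq_iff [simp]: "cell i c = cell j d \<longleftrightarrow> i = j \<and> c = d"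
  by (metis row_cell lev_cell)

text \<open>On level c, row i belongs to the block with index \<open>i div c\<close>. The relation
  is reflexive; loops are excluded only in \<open>cell_graph\<close>.\<close>

definition adj :: "nat \<Rightarrow> nat \<Rightarrow> bool" where
  "adj u v \<longleftrightarrow> row u = row v \<or> lev u = lev v \<and> row u div lev u = row v div lev v"

lemma adj_sym: "adj u v \<longleftrightarrow> adj v u"
  by (auto simp: adj_def)

text \<open>Adjacency does not refer to \<open>S\<close>, so every graph met during the run is again
  a \<open>cell_graph\<close>, of a smaller set.\<close>

definition cell_graph :: "nat set \<Rightarrow> nat ugraph" where
  "cell_graph S = \<lparr>verts = S, edges = {{u, v} | u v. u \<in> S \<and> v \<in> S \<and> u \<noteq> v \<and> adj u v}\<rparr>"

lemma verts_cell_graph [simp]: "verts (cell_graph S) = S"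
  by (simp add: cell_graph_def)

lemma edge_cell_graph [simp]:
  "{u, v} \<in> edges (cell_graph S) \<longleftrightarrow> u \<in> S \<and> v \<in> S \<and> u \<noteq> v \<and> adj u v"
  by (auto simp: cell_graph_def doubleton_eq_iff adj_sym)

lemma simple_cell_graph: "finite S \<Longrightarrow> simple_graph (cell_graph S)"
  by (auto simp: simple_graph_def cell_graph_def)

lemma delete_verts_cell_graph: "delete_verts (cell_graph S) T = cell_graph (S - T)"
  by (auto simp: delete_verts_def cell_graph_def)

lemma clique_cell_graph: "clique (cell_graph S) K \<longleftrightarrow> K \<subseteq> S \<and> (\<forall>u\<in>K. \<forall>v\<in>K. adj u v)"
  by (auto simp: clique_def pairwise_def adj_def)

section \<open>Rows, blocks and the cliques they contain\<close>

definition grid :: "nat \<Rightarrow> nat \<Rightarrow> nat set" where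
  "grid N k = {v. row v < N \<and> lev v \<in> {1..k}}"

definition row_part :: "nat \<Rightarrow> nat \<Rightarrow> nat set" where
  "row_part k i = {v. row v = i \<and> lev v \<in> {1..k}}"

text \<open>Blocks are not cut off at row N, so for positive c each has exactly c vertices; which of
  them lie in a grid is settled separately.\<close>

definition block :: "nat \<Rightarrow> nat \<Rightarrow> nat set" where
  "block c q = {v. lev v = c \<and> row v div c = q}"

lemma grid_eq: "grid N k = (\<lambda>(i, c). cell i c) ` ({..<N} \<times> {1..k})"
  by (force simp: grid_def image_iff)

lemma finite_grid [simp]: "finite (grid N k)"
  by (simp add: grid_eq)

lemma sum_grid: "(\<Sum>v\<in>grid N k. f (lev v)) = N * (\<Sum>c\<in>{1..k}. f c)" for f :: "nat \<Rightarrow> nat"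
proof -
  have "(\<Sum>v\<in>grid N k. f (lev v)) = (\<Sum>(i, c)\<in>{..<N} \<times> {1..k}. f c)"
    unfolding grid_eq by (subst sum.reindex) (auto simp: inj_on_def intro!: sum.cong)
  also have "\<dots> = N * (\<Sum>c\<in>{1..k}. f c)"
    by (simp add: sum.cartesian_product[symmetric])
  finally show ?thesis .
qed

lemma card_grid: "card (grid N k) = N * k"
  using sum_grid[of "\<lambda>_. 1" N k] by simp

lemma card_row_part [simp]: "card (row_part k i) = k"
proof -
  have "row_part k i = cell i ` {1..k}"
    by (force simp: row_part_def image_iff)
  then show ?thesis
    by (simp add: card_image inj_on_def)
qed

lemma block_eq:
  assumes "c > 0"
  shows "block c q = (\<lambda>i. cell i c) ` {q * c..<q * c + c}"
proof (intro set_eqI iffI)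
  fix v assume "v \<in> block c q"
  then have "v = cell (row v) c" "row v \<in> {q * c..<q * c + c}"
    using assms dividend_less_div_times[of c "row v"] by (auto simp: block_def add.commute)
  then show "v \<in> (\<lambda>i. cell i c) ` {q * c..<q * c + c}"
    by blast
qed (auto simp: block_def algebra_simps intro!: div_nat_eqI)

lemma card_block [simp]: "c > 0 \<Longrightarrow> card (block c q) = c"
  by (simp add: block_eq card_image inj_on_def)

text \<open>Two adjacent vertices in different rows share a block, and this block then captures the
  whole clique.\<close>

lemma clique_in_row_or_block:
  assumes "clique (cell_graph (grid N k)) K" "K \<noteq> {}"
  obtains (row) i where "K \<subseteq> row_part k i" | (block) c q where "c \<in> {1..k}" "K \<subseteq> block c q"
proof (cases "\<exists>i. \<forall>v\<in>K. row v = i")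
  case True
  then obtain i where "\<forall>v\<in>K. row v = i" ..
  then have "K \<subseteq> row_part k i"
    using assms(1) by (auto simp: clique_cell_graph row_part_def grid_def)
  then show ?thesis
    by (rule that(1))
next
  case False
  then obtain u v where uv: "u \<in> K" "v \<in> K" "row u \<noteq> row v"
    using assms(2) by blast
  have adj: "adj x y" if "x \<in> K" "y \<in> K" for x y
    using assms(1) that by (auto simp: clique_cell_graph)
  \<comment> \<open>\<open>w\<close> shares a row with at most one of \<open>u\<close> and
    \<open>v\<close>, so it is joined to the other through their common block.\<close>
  have "K \<subseteq> block (lev u) (row u div lev u)"
  proof
    fix w assume "w \<in> K"
    then show "w \<in> block (lev u) (row u div lev u)"
      using adj[of u v] adj[of u w] adj[of v w] uv by (auto simp: block_def adj_def)
  qed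
  moreover have "lev u \<in> {1..k}"
    using assms(1) uv(1) by (auto simp: clique_cell_graph grid_def)
  ultimately show ?thesis
    by (rule that(2)[rotated])
qed

lemma card_clique_le:
  assumes "clique (cell_graph S) K" "S \<subseteq> grid N k"
  shows "card K \<le> k"
proof (cases "K = {}")
  case False
  have "clique (cell_graph (grid N k)) K"
    using assms by (auto simp: clique_cell_graph)
  then show ?thesis
    using False
  proof (cases rule: clique_in_row_or_block)
    case (row i)
    \<comment> \<open>Positive cardinality implies finiteness; for k = 0 the row part is
      empty.\<close>
    moreover have "finite (row_part k i)"
      using card_row_part[of k i] by (cases k) (auto intro: card_ge_0_finite simp: row_part_def)
    ultimately show ?thesis
      using card_mono by fastforce
  next
    case (block c q)
    moreover have "finite (block c q)"
      using block card_block[of c q] by (intro card_ge_0_finite) auto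
    ultimately show ?thesis
      using card_mono[of "block c q" K] card_block[of c q] by auto
  qed
qed simp

lemma clique_block: "block c q \<subseteq> S \<Longrightarrow> clique (cell_graph S) (block c q)"
  by (auto simp: clique_cell_graph block_def adj_def)

lemma clique_row_part: "row_part k i \<subseteq> S \<Longrightarrow> clique (cell_graph S) (row_part k i)"
  by (auto simp: clique_cell_graph row_part_def adj_def)

text \<open>Any surviving row part or block with k vertices certifies the clique number, even if
  level k is partly removed.\<close>

lemma clique_number_grid:
  assumes "S \<subseteq> grid N k" "clique (cell_graph S) K" "card K = k"
  shows "clique_number (cell_graph S) = k"
  using clique_number_eqI[of "cell_graph S" K k] card_clique_le[OF _ assms(1)] assms
    finite_subset[OF assms(1)] by simp

lemma row_part_subset_grid: "i < N \<Longrightarrow> j \<le> k \<Longrightarrow> row_part j i \<subseteq> grid N k"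
  by (auto simp: row_part_def grid_def)

text \<open>A row index of at least N would have a quotient of at least
  \<open>N div c\<close>.\<close>

lemma row_less_of_block:
  assumes "c dvd N" "q < N div c" "v \<in> block c q"
  shows "row v < N"
  using assms by (auto simp: block_def) (metis div_le_mono dvd_div_mult_self linorder_not_le)

lemma block_subset_grid:
  assumes "c dvd N" "q < N div c" "c \<in> {1..k}"
  shows "block c q \<subseteq> grid N k"
  using row_less_of_block[OF assms(1,2)] assms(3) by (auto simp: block_def grid_def)

text \<open>Divisibility guarantees that no incomplete block is left over, so the blocks with index
  below \<open>N div c\<close> exhaust level c.\<close>

lemma block_index_less:
  fixes N :: nat
  assumes "c dvd N" "i < N"
  shows "i div c < N div c"
  using assms by (simp add: less_mult_imp_div_less)

section \<open>A run of the algorithm\<close>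

text \<open>As long as one block of level k is left, it is itself a maximum clique and may be chosen
  next; \<open>3 \<le> k\<close> makes the clique step the applicable one.\<close>

lemma remove_blocks:
  assumes "k dvd N" "3 \<le> k" "j \<le> N div k"
  shows "greedy_edmonds_step\<^sup>*\<^sup>* (cell_graph (grid N k), X)
           (cell_graph (grid N k - (\<Union>q<j. block k q)), X \<union> block k ` {..<j})"
  using assms(3)
proof (induction j)
  case (Suc j)
  let ?S = "grid N k - (\<Union>q<j. block k q)"
  \<comment> \<open>Blocks of one level are disjoint, so block j survives the removal of the earlier
    ones.\<close>
  have sub: "block k j \<subseteq> ?S"
    using block_subset_grid[of k N j k] assms Suc.prems by (auto simp: block_def)
  have num: "clique_number (cell_graph ?S) = k"
    using assms sub by (intro clique_number_grid[of _ N k "block k j"] clique_block) auto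
  moreover have "?S \<noteq> {}"
    using sub card_block[of k j] assms(2) by (metis card.empty not_numeral_le_zero subset_empty neq0_conv)
  ultimately have "greedy_edmonds_step (cell_graph ?S, X \<union> block k ` {..<j})
      (delete_verts (cell_graph ?S) (block k j), insert (block k j) (X \<union> block k ` {..<j}))"
    using assms(2) sub
    by (intro clique_step) (auto simp: maximum_clique_def intro: clique_block)
  moreover have "?S - block k j = grid N k - (\<Union>q<Suc j. block k q)"
    by (auto simp: lessThan_Suc)
  ultimately show ?case
    using Suc by (simp add: delete_verts_cell_graph lessThan_Suc)
qed simp

lemma remove_level:
  assumes "Suc k dvd N" "2 \<le> k"
  shows "greedy_edmonds_step\<^sup>*\<^sup>* (cell_graph (grid N (Suc k)), X)
           (cell_graph (grid N k), X \<union> block (Suc k) ` {..<N div Suc k})"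
proof -
  have "grid N (Suc k) - (\<Union>q<N div Suc k. block (Suc k) q) = grid N k"
    using block_index_less[OF assms(1)] by (fastforce simp: grid_def block_def le_Suc_eq)
  then show ?thesis
    using remove_blocks[OF assms(1) _ order_refl, of X] assms(2) by simp
qed

lemma remove_levels:
  assumes "\<And>c. c \<in> {3..l} \<Longrightarrow> c dvd N" "2 \<le> l"
  shows "greedy_edmonds_step\<^sup>*\<^sup>* (cell_graph (grid N l), X)
           (cell_graph (grid N 2), X \<union> (\<Union>c\<in>{3..l}. block c ` {..<N div c}))"
  using assms(2,1)
\<comment> \<open>The top level goes first, so the induction hypothesis is applied to
  \<open>X\<close> enlarged by its blocks.\<close>
proof (induction l arbitrary: X rule: dec_induct)
  case (step k)
  have "greedy_edmonds_step\<^sup>*\<^sup>* (cell_graph (grid N (Suc k)), X)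
          (cell_graph (grid N k), X \<union> block (Suc k) ` {..<N div Suc k})"
    using step by (intro remove_level) auto
  also have "greedy_edmonds_step\<^sup>*\<^sup>* \<dots> (cell_graph (grid N 2),
      X \<union> block (Suc k) ` {..<N div Suc k} \<union> (\<Union>c\<in>{3..k}. block c ` {..<N div c}))"
    using step by auto
  also have "X \<union> block (Suc k) ` {..<N div Suc k} \<union> (\<Union>c\<in>{3..k}. block c ` {..<N div c}) =
      X \<union> (\<Union>c\<in>{3..Suc k}. block c ` {..<N div c})"
    using step.hyps by (auto simp: atLeastAtMostSuc_conv)
  finally show ?case .
qed simp

text \<open>A row part with two levels is a single edge; the second union is the perfect matching
  taken in the last step.\<close>

definition run_output :: "nat \<Rightarrow> nat \<Rightarrow> nat set set" where
  "run_output N l = (\<Union>c\<in>{3..l}. block c ` {..<N div c}) \<union> row_part 2 ` {..<N}"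

lemma Union_row_parts: "\<Union> (row_part k ` {..<N}) = grid N k"
  by (auto simp: row_part_def grid_def)

lemma row_part_eq_iff: "k > 0 \<Longrightarrow> row_part k i = row_part k j \<longleftrightarrow> i = j"
proof
  assume "k > 0" "row_part k i = row_part k j"
  moreover have "cell i 1 \<in> row_part k i"
    using \<open>k > 0\<close> by (simp add: row_part_def)
  ultimately show "i = j"
    by (auto simp: row_part_def)
qed simp

text \<open>These N edges cover all 2 * N vertices, so \<open>card_matching_le\<close> excludes a
  larger matching.\<close>

lemma maximum_matching_row_parts:
  "maximum_matching (cell_graph (grid N 2)) (row_part 2 ` {..<N})"
  unfolding maximum_matching_def
proof (intro conjI allI impI)
  have "row_part 2 i = {cell i 1, cell i 2}" for i
    by (auto simp: row_part_def eq_cell_iff)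
  then have "row_part 2 i \<in> edges (cell_graph (grid N 2))" if "i < N" for i
    using that by (simp add: grid_def adj_def)
  then show "matching (cell_graph (grid N 2)) (row_part 2 ` {..<N})"
    by (auto simp: matching_def disjoint_def row_part_def)
next
  fix M assume "matching (cell_graph (grid N 2)) M"
  then have "2 * card M \<le> N * 2"
    using card_matching_le[of "cell_graph (grid N 2)" M] by (simp add: simple_cell_graph card_grid)
  then show "card M \<le> card (row_part 2 ` {..<N})"
    by (simp add: card_image inj_on_def row_part_eq_iff)
qed

lemma greedy_edmonds_run_output:
  assumes "\<And>c. c \<in> {3..l} \<Longrightarrow> c dvd N" "2 \<le> l" "N > 0"
  shows "greedy_edmonds_output (cell_graph (grid N l)) (run_output N l)"
proof -
  let ?Y = "\<Union>c\<in>{3..l}. block c ` {..<N div c}" and ?M = "row_part 2 ` {..<N}"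
  \<comment> \<open>Row 0 exists because N is positive; it witnesses both that vertices remain and
    that the clique number is 2.\<close>
  have r: "row_part 2 0 \<subseteq> grid N 2"
    using assms(3) by (intro row_part_subset_grid) auto
  then have "grid N 2 \<noteq> {}"
    using card_row_part[of 2 0] by (metis card.empty subset_empty zero_neq_numeral)
  moreover have "clique_number (cell_graph (grid N 2)) = 2"
    using r by (intro clique_number_grid[of _ N 2 "row_part 2 0"] clique_row_part) auto
  ultimately have "greedy_edmonds_step (cell_graph (grid N 2), ?Y)
      (delete_verts (cell_graph (grid N 2)) (\<Union> ?M), ?Y \<union> ?M)"
    by (intro matching_step maximum_matching_row_parts) auto
  then have "greedy_edmonds_step\<^sup>*\<^sup>* (cell_graph (grid N l), {}) (cell_graph {}, run_output N l)"
    using remove_levels[OF assms(1,2), of "{}"]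
    by (auto simp: delete_verts_cell_graph Union_row_parts run_output_def
        intro: rtranclp.rtrancl_into_rtrancl)
  then show ?thesis
    unfolding greedy_edmonds_output_def by fastforce
qed

section \<open>Counting edges\<close>

lemma clique_partition_rows:
  assumes "k > 0"
  shows "clique_partition (cell_graph (grid N k)) (row_part k ` {..<N})"
  unfolding clique_partition_def
proof
  have "row_part k i \<noteq> {}" for i
    using card_row_part[of k i] assms by force
  then show "partition_on (verts (cell_graph (grid N k))) (row_part k ` {..<N})"
    by (auto simp: partition_on_def Union_row_parts disjoint_def) (auto simp: row_part_def)
qed (use row_part_subset_grid in \<open>blast intro: clique_row_part\<close>)

text \<open>Levels 1 and 2 are covered by matching edges, level c \<ge> 3 by blocks of size c; the
  maximum merges both cases into a function of the level.\<close>

lemma card_run_output_part: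
  assumes "K \<in> run_output N l" "v \<in> K"
  shows "card K = max 2 (lev v)"
  using assms by (auto simp: run_output_def) (auto simp: block_def row_part_def)

lemma clique_partition_run_output:
  assumes "\<And>c. c \<in> {3..l} \<Longrightarrow> c dvd N" "2 \<le> l"
  shows "clique_partition (cell_graph (grid N l)) (run_output N l)"
proof -
  let ?X = "run_output N l"
  have sub: "K \<subseteq> grid N l" if "K \<in> ?X" for K
    using that unfolding run_output_def
  proof (elim UnE UN_E imageE)
    fix c q assume "c \<in> {3..l}" "K = block c q" "q \<in> {..<N div c}"
    then show ?thesis
      using assms(1) by (simp add: block_subset_grid)
  qed (use assms(2) in \<open>simp add: row_part_subset_grid\<close>)
  have "v \<in> \<Union> ?X" if "v \<in> grid N l" for v
  proof (cases "3 \<le> lev v")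
    case True
    then have c: "lev v \<in> {3..l}" "row v < N"
      using that by (auto simp: grid_def)
    then have "row v div lev v < N div lev v" "v \<in> block (lev v) (row v div lev v)"
      using assms(1) by (auto simp: block_def intro: block_index_less)
    then show ?thesis
      using c(1) unfolding run_output_def by blast
  next
    case False
    then have "v \<in> row_part 2 (row v)" "row v < N"
      using that by (auto simp: row_part_def grid_def)
    then show ?thesis
      unfolding run_output_def by blast
  qed
  then have "\<Union> ?X = grid N l"
    using sub by blast
  \<comment> \<open>Blocks use levels from 3 upwards, row parts only levels 1 and 2.\<close>
  moreover have "disjoint ?X"
    unfolding disjoint_def run_output_def by (auto simp: block_def row_part_def)
  moreover have "card K \<noteq> 0" if "K \<in> ?X" for K
    using that by (auto simp: run_output_def)
  then have "{} \<notin> ?X"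
    by force
  moreover have "clique (cell_graph (grid N l)) K" if "K \<in> ?X" for K
    using that sub[OF that] by (auto simp: run_output_def intro: clique_block clique_row_part)
  ultimately show ?thesis
    by (simp add: clique_partition_def partition_on_def)
qed

text \<open>In the row partition every vertex attains the bound k - 1 of
  \<open>card_partition_edges_le\<close>.\<close>

lemma OPT_grid:
  assumes "k > 0"
  shows "OPT (cell_graph (grid N k)) = N * (k choose 2)"
proof -
  let ?G = "cell_graph (grid N k)" and ?X = "row_part k ` {..<N}"
  have cp: "clique_partition ?G ?X"
    by (rule clique_partition_rows[OF assms])
  have *: "2 * card (partition_edges ?G ?X) = N * k * (k - 1)"
    by (subst card_partition_edges_eq[OF simple_cell_graph cp, of "\<lambda>_. k"]) (auto simp: card_grid)
  have "card (partition_edges ?G Y) \<le> card (partition_edges ?G ?X)"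
    if "clique_partition ?G Y" for Y
  proof -
    have "2 * card (partition_edges ?G Y) \<le> N * k * (k - 1)"
      using card_partition_edges_le[OF simple_cell_graph that, of k]
        card_clique_le[of "grid N k" _ N k] by (simp add: card_grid)
    then show ?thesis
      using * by linarith
  qed
  then have "OPT ?G = card (partition_edges ?G ?X)"
    using cp by (intro OPT_eqI) (auto simp: simple_cell_graph)
  moreover have "2 * (N * (k choose 2)) = N * k * (k - 1)"
    using two_times_choose_two[of k] by simp
  ultimately show ?thesis
    using * by linarith
qed

text \<open>The terms c - 1 alone would sum to the binomial coefficient; the extra 1 comes from
  level 1, whose vertices are matched instead of being singletons.\<close>

lemma sum_max_two:
  assumes "l \<ge> 1"
  shows "(\<Sum>c\<in>{1..l}. max 2 c - 1) = (l choose 2) + 1"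
  using assms
proof (induction l rule: dec_induct)
  case (step n)
  then show ?case
    by (simp add: numeral_2_eq_2)
qed simp

lemma edges_run_output:
  assumes "\<And>c. c \<in> {3..l} \<Longrightarrow> c dvd N" "2 \<le> l"
  shows "2 * card (partition_edges (cell_graph (grid N l)) (run_output N l)) =
    N * ((l choose 2) + 1)"
proof -
  have "2 * card (partition_edges (cell_graph (grid N l)) (run_output N l)) =
      (\<Sum>v\<in>grid N l. max 2 (lev v) - 1)"
    using card_partition_edges_eq[OF simple_cell_graph clique_partition_run_output[OF assms]
        card_run_output_part] by simp
  also have "\<dots> = N * ((l choose 2) + 1)"
    using sum_grid[of "\<lambda>c. max 2 c - 1" N l] sum_max_two[of l] assms(2) by simp
  finally show ?thesis .
qed

theorem theorem4:
  "\<exists>(G :: nat \<Rightarrow> nat ugraph) (X :: nat \<Rightarrow> nat set set).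
     (\<forall>l\<ge>3. simple_graph (G l) \<and> clique_number (G l) = l \<and>
             clique_partition (G l) (X l) \<and> greedy_edmonds_output (G l) (X l)) \<and>
     (\<lambda>l. (real (l choose 2) + 1) / (2 * real (l choose 2)) *
           (real (OPT (G l)) / real (card (partition_edges (G l) (X l)))))
       \<longlonglongrightarrow> 1"
proof (intro exI conjI allI impI)
  \<comment> \<open>The factorial is a positive number of rows divisible by every level, as the
    cutting into blocks demands.\<close>
  let ?G = "\<lambda>l. cell_graph (grid (fact l) l)" and ?X = "\<lambda>l. run_output (fact l) l"
  have dvd: "c dvd fact l" if "c \<in> {3..l}" for c l :: nat
    using that by (intro dvd_fact) auto
  {
    fix l :: nat assume l: "3 \<le> l"
    show "simple_graph (?G l)"
      by (simp add: simple_cell_graph)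
    show "clique_number (?G l) = l"
      by (intro clique_number_grid[of _ "fact l" l "row_part l 0"] clique_row_part
          row_part_subset_grid) auto
    show "clique_partition (?G l) (?X l)"
      using l dvd by (intro clique_partition_run_output) auto
    show "greedy_edmonds_output (?G l) (?X l)"
      using l dvd by (intro greedy_edmonds_run_output) auto
  }
  have ratio: "(real (l choose 2) + 1) / (2 * real (l choose 2)) *
      (real (OPT (?G l)) / real (card (partition_edges (?G l) (?X l)))) = 1" if l: "3 \<le> l" for l
  proof -
    have "2 * card (partition_edges (?G l) (?X l)) = fact l * ((l choose 2) + 1)"
      using l dvd by (intro edges_run_output) auto
    then have "real (2 * card (partition_edges (?G l) (?X l))) = real (fact l * ((l choose 2) + 1))"
      by (rule arg_cong)
    then have "real (card (partition_edges (?G l) (?X l))) = fact l * (real (l choose 2) + 1) / 2"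
      by (simp add: algebra_simps)
    moreover have "real (OPT (?G l)) = fact l * real (l choose 2)"
      using l by (simp add: OPT_grid)
    moreover have "real (l choose 2) > 0"
      using l by simp
    \<comment> \<open>The number of rows \<open>f\<close> cancels, and b is the binomial
      coefficient.\<close>
    moreover have "(b + 1) / (2 * b) * (f * b / (f * (b + 1) / 2)) = 1" if "b > 0" "f > 0"
      for b f :: real
      using that by (simp add: divide_simps)
    ultimately show ?thesis
      by (simp only: fact_gt_zero)
  qed
  show "(\<lambda>l. (real (l choose 2) + 1) / (2 * real (l choose 2)) *
      (real (OPT (?G l)) / real (card (partition_edges (?G l) (?X l))))) \<longlonglongrightarrow> 1"
    \<comment> \<open>For l \<le> 1 the first factor is a division by zero with value 0, so the
      sequence equals 1 only eventually.\<close>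
    by (intro tendsto_eventually eventually_sequentiallyI[of 3] ratio)
qed

end
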